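(* Let $X$ be any Banach space over $\mathbb R$. Let $T:X\to X$ be a bounded linear operator with $\|T\|\le1$ and let $P:X\to X$ be a projection with $TP=PT=P$. Then the following statements are equivalent: (i) $T$ is uniformly $P$-ergodic, i.e. $\|T^n-P\|\to0$ as $n\to\infty$; (ii) there is $n_0\in\mathbb N$ such that $\|T^{n_0}|_{(I-P)(X)}\|<1$, where $T^{n_0}|_{(I-P)(X)}$ denotes the restriction of $T^{n_0}$ to the subspace $(I-P)(X)$.
   Context: A projection is a bounded linear operator $P$ with $P^2=P$. $\mathbb N=\{1,2,\dots\}$. The norm of an operator on the zero space is $0$. *)

theory Defs
  imports "HOL-Analysis.Analysis"
begin

definition projection :: "('a::real_normed_vector \<Rightarrow> 'a) \<Rightarrow> bool" where
  "projection P \<longleftrightarrow> bounded_linear P \<and> P \<circ> P = P"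

definition uniformly_ergodic ::
  "('a::real_normed_vector \<Rightarrow> 'a) \<Rightarrow> ('a \<Rightarrow> 'a) \<Rightarrow> bool" where
  "uniformly_ergodic T P \<longleftrightarrow> (\<lambda>n. onorm (\<lambda>x. (T ^^ n) x - P x)) \<longlonglongrightarrow> 0"

(* The library's onorm with the supremum taken over a subspace S only.
   As in onorm, x = 0 contributes 0 / 0 = 0, so the norm on the zero subspace is 0.
   Meaningful when S is a linear subspace on which f is bounded: the supremum is
   taken in the reals, so the quotients must be bounded above. *)
definition onorm_on ::
  "'a::real_normed_vector set \<Rightarrow> ('a \<Rightarrow> 'b::real_normed_vector) \<Rightarrow> real" where
  "onorm_on S f = (SUP x\<in>S. norm (f x) / norm x)"

end

theory Submission
  imports Defs
begin

text \<open>
  Since \<open>T P = P\<close>, the difference \<open>T\<^sup>n - P\<close> factors as \<open>T\<^sup>n (I - P)\<close>. So, up to the bounded factor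
  \<open>\<parallel>I - P\<parallel>\<close>, uniform \<open>P\<close>-ergodicity says that the powers of the restriction of \<open>T\<close> to
  \<open>R = (I - P)(X)\<close> tend to zero in norm.

  If \<open>T\<^sup>n \<rightarrow> P\<close> in norm, some \<open>\<parallel>T\<^sup>n - P\<parallel>\<close> is below \<open>1\<close>; this number bounds the norm of \<open>T\<^sup>n\<close> on
  \<open>R\<close>, because \<open>P\<close> vanishes there.

  Conversely, \<open>R\<close> is invariant under \<open>T\<close>, because \<open>T\<close> commutes with \<open>P\<close>. Hence a bound \<open>q < 1\<close> for
  the norm of \<open>T\<^sup>m\<close> on \<open>R\<close> can be iterated, and the contractivity of \<open>T\<close> takes care of the exponents
  between consecutive multiples of \<open>m\<close>: on \<open>R\<close> the power \<open>T\<^sup>n\<close> has norm at most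
  \<open>q ^ (n div m)\<close> (lemma \<open>norm_funpow_le_geometric\<close>), which tends to \<open>0\<close>.
\<close>

lemma bounded_linear_funpow:
  fixes T :: "'a::real_normed_vector \<Rightarrow> 'a"
  assumes "bounded_linear T"
  shows "bounded_linear (T ^^ n)"
proof (induction n)
  case 0
  show ?case by (simp add: id_def bounded_linear_ident)
next
  case (Suc n)
  show ?case
    using bounded_linear_compose[OF assms Suc] by (simp add: o_def)
qed

text \<open>The supremum in \<^const>\<open>onorm_on\<close> is taken over the reals, so it is an upper bound of the
  quotients only because the operator norm on the whole space bounds them.\<close>
lemma quotient_le_onorm_on:
  assumes "bounded_linear f" and "x \<in> S"
  shows "norm (f x) / norm x \<le> onorm_on S f"
proof -
  have "bdd_above ((\<lambda>x. norm (f x) / norm x) ` S)"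
    using le_onorm[OF assms(1)] by (intro bdd_aboveI[of _ "onorm f"]) auto
  then show ?thesis
    unfolding onorm_on_def using assms(2) by (rule cSUP_upper[rotated])
qed

lemma norm_le_onorm_on:
  assumes "bounded_linear f" and "x \<in> S"
  shows "norm (f x) \<le> onorm_on S f * norm x"
proof (cases "x = 0")
  case True
  then show ?thesis by (simp add: bounded_linear.linear[OF assms(1)] linear_0)
next
  case False
  with quotient_le_onorm_on[OF assms] show ?thesis by (simp add: divide_le_eq)
qed

lemma onorm_on_nonneg:
  assumes "bounded_linear f" and "x \<in> S"
  shows "0 \<le> onorm_on S f"
  using quotient_le_onorm_on[OF assms] by (rule order_trans[rotated]) simp

lemma onorm_on_le:
  assumes "S \<noteq> {}" and "0 \<le> b" and "\<And>x. x \<in> S \<Longrightarrow> norm (f x) \<le> b * norm x"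
  shows "onorm_on S f \<le> b"
  unfolding onorm_on_def
proof (rule cSUP_least[OF assms(1)])
  fix x assume "x \<in> S"
  with assms show "norm (f x) / norm x \<le> b" by (cases "x = 0") (auto simp: divide_le_eq)
qed

lemma norm_funpow_le:
  fixes T :: "'a::real_normed_vector \<Rightarrow> 'a"
  assumes "\<And>x. norm (T x) \<le> norm x"
  shows "norm ((T ^^ n) x) \<le> norm x"
  by (induction n) (auto intro: order_trans[OF assms])

text \<open>Write \<open>n = m * (n div m) + n mod m\<close>. Each of the \<open>n div m\<close> blocks of length \<open>m\<close> contributes a
  factor \<open>q\<close>, as the orbit never leaves the invariant set \<open>S\<close>, and the remaining steps do not
  increase the norm.\<close>
lemma norm_funpow_le_geometric:
  fixes T :: "'a::real_normed_vector \<Rightarrow> 'a"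
  assumes contr: "\<And>x. norm (T x) \<le> norm x"
    and inv: "\<And>x. x \<in> S \<Longrightarrow> T x \<in> S"
    and q: "0 \<le> q" "\<And>x. x \<in> S \<Longrightarrow> norm ((T ^^ m) x) \<le> q * norm x"
    and x: "x \<in> S"
  shows "norm ((T ^^ n) x) \<le> q ^ (n div m) * norm x"
proof -
  have invn: "(T ^^ j) x \<in> S" for j
    using x inv by (induction j) auto
  have block: "norm ((T ^^ (m * k)) x) \<le> q ^ k * norm x" for k
  proof (induction k)
    case 0
    show ?case by simp
  next
    case (Suc k)
    have "norm ((T ^^ (m * Suc k)) x) = norm ((T ^^ m) ((T ^^ (m * k)) x))"
      by (simp add: funpow_add)
    also have "\<dots> \<le> q * norm ((T ^^ (m * k)) x)"
      by (rule q(2)[OF invn])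
    also have "\<dots> \<le> q * (q ^ k * norm x)"
      by (rule mult_left_mono[OF Suc q(1)])
    finally show ?case by (simp add: mult.assoc)
  qed
  have "(T ^^ n) x = (T ^^ (n mod m + m * (n div m))) x"
    by simp
  also have "\<dots> = (T ^^ (n mod m)) ((T ^^ (m * (n div m))) x)"
    by (simp only: funpow_add o_apply)
  finally have "norm ((T ^^ n) x) \<le> norm ((T ^^ (m * (n div m))) x)"
    using norm_funpow_le[of T, OF contr] by metis
  then show ?thesis using block by (rule order_trans)
qed

theorem theorem4p8:
  fixes T P :: "'a::banach \<Rightarrow> 'a"
  assumes "bounded_linear T" and "onorm T \<le> 1"
    and "projection P"
    and "T \<circ> P = P" and "P \<circ> T = P"
  shows "uniformly_ergodic T P \<longleftrightarrow>
    (\<exists>n0\<ge>1. onorm_on (range (\<lambda>x. x - P x)) (T ^^ n0) < 1)"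
proof -
  define R where "R = range (\<lambda>x. x - P x)"
  have blP: "bounded_linear P" and PP: "P (P x) = P x" for x
    using assms(3) by (auto simp: projection_def fun_eq_iff)
  have TP: "T (P x) = P x" and PT: "P (T x) = P x" for x
    using assms(4,5) by (auto simp: fun_eq_iff)
  have blTn: "bounded_linear (T ^^ n)" for n
    by (rule bounded_linear_funpow[OF assms(1)])
  have blD: "bounded_linear (\<lambda>x. (T ^^ n) x - P x)" for n
    by (rule bounded_linear_sub[OF blTn blP])
  have blQ: "bounded_linear (\<lambda>x. x - P x)"
    by (rule bounded_linear_sub[OF bounded_linear_ident blP])
  have contr: "norm (T x) \<le> norm x" for x
    using onorm[OF assms(1), of x] mult_right_mono[OF assms(2), of "norm x"] by simp
  have P_R: "P y = 0" if "y \<in> R" for y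
    using that by (auto simp: R_def PP bounded_linear.linear[OF blP] linear_diff)
  have R0: "0 \<in> R"
    unfolding R_def by (rule range_eqI[of _ _ 0]) (simp add: bounded_linear.linear[OF blP] linear_0)
  have invR: "T y \<in> R" if "y \<in> R" for y
  proof (rule ssubst[of "T y" "T y - P (T y)"])
    show "T y = T y - P (T y)" using P_R[OF that] by (simp add: PT)
  qed (simp add: R_def)
  have TnP: "(T ^^ n) (P x) = P x" for n x
    by (induction n) (auto simp: TP)
  have factor: "(T ^^ n) x - P x = (T ^^ n) (x - P x)" for n x
    by (simp add: bounded_linear.linear[OF blTn] linear_diff TnP)
  show ?thesis
    unfolding R_def[symmetric]
  proof
    assume "uniformly_ergodic T P"
    then have "\<forall>\<^sub>F n in sequentially. onorm (\<lambda>x. (T ^^ n) x - P x) < 1"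
      unfolding uniformly_ergodic_def by (rule order_tendstoD(2)) simp
    then obtain N where N: "\<And>n. n \<ge> N \<Longrightarrow> onorm (\<lambda>x. (T ^^ n) x - P x) < 1"
      by (auto simp: eventually_sequentially)
    let ?n = "max N 1"
    have "onorm_on R (T ^^ ?n) \<le> onorm (\<lambda>x. (T ^^ ?n) x - P x)"
    proof (rule onorm_on_le)
      show "R \<noteq> {}" using R0 by blast
      show "0 \<le> onorm (\<lambda>x. (T ^^ ?n) x - P x)" by (rule onorm_pos_le[OF blD])
      fix y assume "y \<in> R"
      then show "norm ((T ^^ ?n) y) \<le> onorm (\<lambda>x. (T ^^ ?n) x - P x) * norm y"
        using onorm[OF blD, of ?n y] by (simp add: P_R)
    qed
    also have "\<dots> < 1" by (rule N) simp
    finally show "\<exists>n0\<ge>1. onorm_on R (T ^^ n0) < 1"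
      by (intro exI[of _ ?n]) simp
  next
    assume "\<exists>n0\<ge>1. onorm_on R (T ^^ n0) < 1"
    then obtain m where m: "m \<ge> 1" "onorm_on R (T ^^ m) < 1" by blast
    define q where "q = onorm_on R (T ^^ m)"
    have q: "0 \<le> q" "q < 1"
      using m onorm_on_nonneg[OF blTn R0] by (auto simp: q_def)
    define C where "C = onorm (\<lambda>x. x - P x)"
    have bound: "onorm (\<lambda>x. (T ^^ n) x - P x) \<le> q ^ (n div m) * C" for n
    proof (rule onorm_bound)
      show "0 \<le> q ^ (n div m) * C"
        using q onorm_pos_le[OF blQ] by (simp add: C_def)
      fix x
      have "norm ((T ^^ n) x - P x) \<le> q ^ (n div m) * norm (x - P x)"
        unfolding factor
        by (rule norm_funpow_le_geometric[of T R, OF contr invR q(1)])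
           (auto simp: q_def R_def intro: norm_le_onorm_on[OF blTn])
      also have "\<dots> \<le> q ^ (n div m) * (C * norm x)"
        unfolding C_def using q onorm[OF blQ, of x] by (intro mult_left_mono) auto
      finally show "norm ((T ^^ n) x - P x) \<le> q ^ (n div m) * C * norm x"
        by (simp add: mult.assoc)
    qed
    have "filterlim (\<lambda>n. n div m) sequentially sequentially"
      using m(1) by (intro filterlim_at_top_div_const_nat) simp
    then have "(\<lambda>n. q ^ (n div m)) \<longlonglongrightarrow> 0"
      using q by (intro filterlim_compose[OF LIMSEQ_realpow_zero])
    then have "(\<lambda>n. q ^ (n div m) * C) \<longlonglongrightarrow> 0"
      by (rule tendsto_mult_left_zero)
    then show "uniformly_ergodic T P"
      unfolding uniformly_ergodic_def
      by (rule tendsto_sandwich[OF _ _ tendsto_const, rotated 2])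
         (auto simp: bound onorm_pos_le[OF blD])
  qed
qed

end
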